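(* Let $R$ be an LNZS ring. Then $R$ is reduced in each of the following cases: (1) $R$ is semiprime. (2) $R$ is left MC2, and every simple singular left $R$-module is Wnil-injective. (3) Every idempotent in $R$ is right semicentral, and every simple singular left $R$-module is Wnil-injective.
   Context: All rings are associative with identity and all modules are unital. $N(R)$ is the set of nilpotent elements and $E(R)$ the set of idempotents of $R$. For $a\in R$, $l(a)=\{x\in R: xa=0\}$. A ring $R$ is LNZS (left nil zero semicommutative) if $l(a)$ is a two-sided ideal of $R$ for every $a\in N(R)$. $R$ is reduced if $N(R)=0$. Let $ME_l(R)=\{e\in E(R): Re \text{ is a minimal left ideal of } R\}$. $R$ is left MC2 if for any $a\in R$ and $e\in ME_l(R)$, $aRe=0$ implies $eRa=0$. An idempotent $e\in E(R)$ is right semicentral if $er=ere$ for all $r\in R$. A left $R$-module $M$ is Wnil-injective if for every nonzero $w\in N(R)$ there exists a positive integer $m$ such that $w^m\neq 0$ and every left $R$-homomorphism $f:Rw^m\to M$ extends to a left $R$-homomorphism $R\to M$. A left $R$-module is singular if each of its elements is annihilated by an essential left ideal of $R$. *)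

theory Defs
  imports "HOL-Algebra.Module" "HOL-Algebra.Ideal_Product"
begin

section \<open>Rings\<close>

definition nilpotents :: "('a, 'r) ring_scheme \<Rightarrow> 'a set" where
  "nilpotents R = {a \<in> carrier R. \<exists>n::nat. n > 0 \<and> a [^]\<^bsub>R\<^esub> n = \<zero>\<^bsub>R\<^esub>}"

definition idempotents :: "('a, 'r) ring_scheme \<Rightarrow> 'a set" where
  "idempotents R = {e \<in> carrier R. e \<otimes>\<^bsub>R\<^esub> e = e}"

definition left_annihilator :: "('a, 'r) ring_scheme \<Rightarrow> 'a \<Rightarrow> 'a set" where
  "left_annihilator R a = {x \<in> carrier R. x \<otimes>\<^bsub>R\<^esub> a = \<zero>\<^bsub>R\<^esub>}"

definition LNZS :: "('a, 'r) ring_scheme \<Rightarrow> bool" where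
  "LNZS R \<longleftrightarrow> (\<forall>a \<in> nilpotents R. ideal (left_annihilator R a) R)"

definition reduced_ring :: "('a, 'r) ring_scheme \<Rightarrow> bool" where
  "reduced_ring R \<longleftrightarrow> nilpotents R = {\<zero>\<^bsub>R\<^esub>}"

text \<open>Semiprime: no nonzero two-sided ideal has square zero.\<close>

definition semiprime_ring :: "('a, 'r) ring_scheme \<Rightarrow> bool" where
  "semiprime_ring R \<longleftrightarrow> (\<forall>I. ideal I R \<and> I \<cdot>\<^bsub>R\<^esub> I = {\<zero>\<^bsub>R\<^esub>} \<longrightarrow> I = {\<zero>\<^bsub>R\<^esub>})"

definition left_ideal :: "'a set \<Rightarrow> ('a, 'r) ring_scheme \<Rightarrow> bool" where
  "left_ideal I R \<longleftrightarrow> additive_subgroup I R \<and> (\<forall>r \<in> carrier R. \<forall>x \<in> I. r \<otimes>\<^bsub>R\<^esub> x \<in> I)"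

definition principal_left_ideal :: "('a, 'r) ring_scheme \<Rightarrow> 'a \<Rightarrow> 'a set" where
  "principal_left_ideal R a = {r \<otimes>\<^bsub>R\<^esub> a | r. r \<in> carrier R}"

definition minimal_left_ideal :: "'a set \<Rightarrow> ('a, 'r) ring_scheme \<Rightarrow> bool" where
  "minimal_left_ideal I R \<longleftrightarrow> left_ideal I R \<and> I \<noteq> {\<zero>\<^bsub>R\<^esub>} \<and>
     (\<forall>J. left_ideal J R \<and> J \<subseteq> I \<longrightarrow> J = {\<zero>\<^bsub>R\<^esub>} \<or> J = I)"

definition essential_left_ideal :: "'a set \<Rightarrow> ('a, 'r) ring_scheme \<Rightarrow> bool" where
  "essential_left_ideal I R \<longleftrightarrow> left_ideal I R \<and>
     (\<forall>J. left_ideal J R \<and> J \<noteq> {\<zero>\<^bsub>R\<^esub>} \<longrightarrow> I \<inter> J \<noteq> {\<zero>\<^bsub>R\<^esub>})"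

definition left_minimal_idempotents :: "('a, 'r) ring_scheme \<Rightarrow> 'a set" where
  "left_minimal_idempotents R =
     {e \<in> idempotents R. minimal_left_ideal (principal_left_ideal R e) R}"

definition left_MC2 :: "('a, 'r) ring_scheme \<Rightarrow> bool" where
  "left_MC2 R \<longleftrightarrow> (\<forall>a \<in> carrier R. \<forall>e \<in> left_minimal_idempotents R.
     (\<forall>r \<in> carrier R. a \<otimes>\<^bsub>R\<^esub> r \<otimes>\<^bsub>R\<^esub> e = \<zero>\<^bsub>R\<^esub>) \<longrightarrow>
     (\<forall>r \<in> carrier R. e \<otimes>\<^bsub>R\<^esub> r \<otimes>\<^bsub>R\<^esub> a = \<zero>\<^bsub>R\<^esub>))"

definition right_semicentral :: "('a, 'r) ring_scheme \<Rightarrow> 'a \<Rightarrow> bool" where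
  "right_semicentral R e \<longleftrightarrow> e \<in> idempotents R \<and>
     (\<forall>r \<in> carrier R. e \<otimes>\<^bsub>R\<^esub> r = e \<otimes>\<^bsub>R\<^esub> r \<otimes>\<^bsub>R\<^esub> e)"


section \<open>Left modules\<close>

text \<open>
  The locale \<open>module\<close> of HOL-Algebra requires a commutative ring of scalars, so unital left
  modules over an arbitrary ring are introduced here, over the same record type
  (its \<open>mult\<close> and \<open>one\<close> fields are irrelevant). The library predicate \<open>submodule\<close> has no
  such restriction and is reused.
\<close>

locale left_module = R?: ring R + M?: abelian_group M
  for R :: "('a, 'r) ring_scheme" (structure) and M :: "('a, 'b, 'm) module_scheme" (structure) +
  assumes smult_closed [simp, intro]:
      "\<lbrakk>a \<in> carrier R; x \<in> carrier M\<rbrakk> \<Longrightarrow> a \<odot>\<^bsub>M\<^esub> x \<in> carrier M"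
    and smult_l_distr:
      "\<lbrakk>a \<in> carrier R; b \<in> carrier R; x \<in> carrier M\<rbrakk> \<Longrightarrow>
       (a \<oplus>\<^bsub>R\<^esub> b) \<odot>\<^bsub>M\<^esub> x = a \<odot>\<^bsub>M\<^esub> x \<oplus>\<^bsub>M\<^esub> b \<odot>\<^bsub>M\<^esub> x"
    and smult_r_distr:
      "\<lbrakk>a \<in> carrier R; x \<in> carrier M; y \<in> carrier M\<rbrakk> \<Longrightarrow>
       a \<odot>\<^bsub>M\<^esub> (x \<oplus>\<^bsub>M\<^esub> y) = a \<odot>\<^bsub>M\<^esub> x \<oplus>\<^bsub>M\<^esub> a \<odot>\<^bsub>M\<^esub> y"
    and smult_assoc1:
      "\<lbrakk>a \<in> carrier R; b \<in> carrier R; x \<in> carrier M\<rbrakk> \<Longrightarrow>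
       (a \<otimes>\<^bsub>R\<^esub> b) \<odot>\<^bsub>M\<^esub> x = a \<odot>\<^bsub>M\<^esub> (b \<odot>\<^bsub>M\<^esub> x)"
    and smult_one [simp]:
      "x \<in> carrier M \<Longrightarrow> \<one>\<^bsub>R\<^esub> \<odot>\<^bsub>M\<^esub> x = x"

definition simple_left_module ::
  "('a, 'r) ring_scheme \<Rightarrow> ('a, 'b, 'm) module_scheme \<Rightarrow> bool" where
  "simple_left_module R M \<longleftrightarrow> left_module R M \<and> carrier M \<noteq> {\<zero>\<^bsub>M\<^esub>} \<and>
     (\<forall>N. submodule N R M \<longrightarrow> N = {\<zero>\<^bsub>M\<^esub>} \<or> N = carrier M)"

definition singular_left_module ::
  "('a, 'r) ring_scheme \<Rightarrow> ('a, 'b, 'm) module_scheme \<Rightarrow> bool" where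
  "singular_left_module R M \<longleftrightarrow> left_module R M \<and>
     (\<forall>x \<in> carrier M. \<exists>L. essential_left_ideal L R \<and> (\<forall>r \<in> L. r \<odot>\<^bsub>M\<^esub> x = \<zero>\<^bsub>M\<^esub>))"

text \<open>
  \<open>left_ideal_hom R I M\<close> is the set of left \<open>R\<close>-homomorphisms \<open>I \<rightarrow> M\<close> for a left ideal \<open>I\<close>;
  values outside \<open>I\<close> are unconstrained. For \<open>I = carrier R\<close> these are the homomorphisms
  \<open>R \<rightarrow> M\<close>.
\<close>

definition left_ideal_hom ::
  "('a, 'r) ring_scheme \<Rightarrow> 'a set \<Rightarrow> ('a, 'b, 'm) module_scheme \<Rightarrow> ('a \<Rightarrow> 'b) set" where
  "left_ideal_hom R I M = {f \<in> I \<rightarrow> carrier M.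
     (\<forall>x \<in> I. \<forall>y \<in> I. f (x \<oplus>\<^bsub>R\<^esub> y) = f x \<oplus>\<^bsub>M\<^esub> f y) \<and>
     (\<forall>r \<in> carrier R. \<forall>x \<in> I. f (r \<otimes>\<^bsub>R\<^esub> x) = r \<odot>\<^bsub>M\<^esub> f x)}"

definition Wnil_injective ::
  "('a, 'r) ring_scheme \<Rightarrow> ('a, 'b, 'm) module_scheme \<Rightarrow> bool" where
  "Wnil_injective R M \<longleftrightarrow> left_module R M \<and>
     (\<forall>w \<in> nilpotents R. w \<noteq> \<zero>\<^bsub>R\<^esub> \<longrightarrow>
       (\<exists>m::nat. m > 0 \<and> w [^]\<^bsub>R\<^esub> m \<noteq> \<zero>\<^bsub>R\<^esub> \<and>
         (\<forall>f \<in> left_ideal_hom R (principal_left_ideal R (w [^]\<^bsub>R\<^esub> m)) M.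
            \<exists>g \<in> left_ideal_hom R (carrier R) M.
              \<forall>x \<in> principal_left_ideal R (w [^]\<^bsub>R\<^esub> m). g x = f x)))"

text \<open>
  A quantifier over all modules has to fix the type of their elements. Every simple left
  \<open>R\<close>-module is isomorphic to a quotient of \<open>R\<close> by a maximal left ideal, whose elements are
  cosets, i.e. sets of elements of \<open>R\<close>; therefore it suffices to range over modules with
  elements of type \<open>'a set\<close>. The theorem \<open>simple_singular_Wnil_injective_any_type\<close> below
  confirms that nothing is lost.
\<close>

definition simple_singular_modules_Wnil_injective :: "('a, 'r) ring_scheme \<Rightarrow> bool" where
  "simple_singular_modules_Wnil_injective R \<longleftrightarrow>
     (\<forall>M :: ('a, 'a set) module.
        simple_left_module R M \<and> singular_left_module R M \<longrightarrow> Wnil_injective R M)"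


section \<open>Independence of the type of module elements\<close>

definition transport_module ::
  "('b \<Rightarrow> 'c) \<Rightarrow> ('a, 'b, 'm) module_scheme \<Rightarrow> ('a, 'c) module" where
  "transport_module h M = \<lparr>carrier = h ` carrier M,
     mult = (\<lambda>x y. undefined), one = undefined, zero = h \<zero>\<^bsub>M\<^esub>,
     add = (\<lambda>x y. h (inv_into (carrier M) h x \<oplus>\<^bsub>M\<^esub> inv_into (carrier M) h y)),
     smult = (\<lambda>r x. h (r \<odot>\<^bsub>M\<^esub> inv_into (carrier M) h x))\<rparr>"

context left_module
begin

lemma submoduleI':
  assumes "H \<subseteq> carrier M" "\<zero>\<^bsub>M\<^esub> \<in> H"
    and add: "\<And>a b. \<lbrakk>a \<in> H; b \<in> H\<rbrakk> \<Longrightarrow> a \<oplus>\<^bsub>M\<^esub> b \<in> H"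
    and smult: "\<And>a x. \<lbrakk>a \<in> carrier R; x \<in> H\<rbrakk> \<Longrightarrow> a \<odot>\<^bsub>M\<^esub> x \<in> H"
  shows "submodule H R M"
proof -
  have neg: "\<ominus>\<^bsub>M\<^esub> x \<in> H" if "x \<in> H" for x
  proof -
    have x: "x \<in> carrier M" using that assms(1) by blast
    have "(\<ominus>\<^bsub>R\<^esub> \<one>\<^bsub>R\<^esub>) \<odot>\<^bsub>M\<^esub> x \<oplus>\<^bsub>M\<^esub> x = \<zero>\<^bsub>M\<^esub>"
    proof -
      have "\<zero>\<^bsub>R\<^esub> \<odot>\<^bsub>M\<^esub> x \<oplus>\<^bsub>M\<^esub> \<zero>\<^bsub>R\<^esub> \<odot>\<^bsub>M\<^esub> x = \<zero>\<^bsub>R\<^esub> \<odot>\<^bsub>M\<^esub> x"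
        using smult_l_distr[of "\<zero>\<^bsub>R\<^esub>" "\<zero>\<^bsub>R\<^esub>" x] x by simp
      then have "\<zero>\<^bsub>R\<^esub> \<odot>\<^bsub>M\<^esub> x = \<zero>\<^bsub>M\<^esub>"
        using M.add.l_cancel_one[of "\<zero>\<^bsub>R\<^esub> \<odot>\<^bsub>M\<^esub> x" "\<zero>\<^bsub>R\<^esub> \<odot>\<^bsub>M\<^esub> x"] x by simp
      then show ?thesis
        using smult_l_distr[of "\<ominus>\<^bsub>R\<^esub> \<one>\<^bsub>R\<^esub>" "\<one>\<^bsub>R\<^esub>" x] x by (simp add: R.l_neg)
    qed
    then have "\<ominus>\<^bsub>M\<^esub> x = (\<ominus>\<^bsub>R\<^esub> \<one>\<^bsub>R\<^esub>) \<odot>\<^bsub>M\<^esub> x"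
      using M.minus_equality[of "(\<ominus>\<^bsub>R\<^esub> \<one>\<^bsub>R\<^esub>) \<odot>\<^bsub>M\<^esub> x" x] x by simp
    then show ?thesis using smult[of "\<ominus>\<^bsub>R\<^esub> \<one>\<^bsub>R\<^esub>" x] that by simp
  qed
  show ?thesis
    using assms neg
    by (auto intro!: submodule.intro subgroup.intro submodule_axioms.intro
        simp flip: a_inv_def)
qed

end

lemma simple_left_module_generated:
  assumes "simple_left_module R M" "x \<in> carrier M" "x \<noteq> \<zero>\<^bsub>M\<^esub>"
  shows "(\<lambda>r. r \<odot>\<^bsub>M\<^esub> x) ` carrier R = carrier M"
proof -
  interpret left_module R M using assms(1) by (simp add: simple_left_module_def)
  let ?N = "(\<lambda>r. r \<odot>\<^bsub>M\<^esub> x) ` carrier R"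
  have x: "x \<in> ?N"
    by (rule image_eqI[of _ _ "\<one>\<^bsub>R\<^esub>"]) (use assms(2) in auto)
  have z: "\<zero>\<^bsub>M\<^esub> \<in> ?N"
  proof (rule image_eqI[of _ _ "\<zero>\<^bsub>R\<^esub>"])
    have "\<zero>\<^bsub>R\<^esub> \<odot>\<^bsub>M\<^esub> x \<oplus>\<^bsub>M\<^esub> \<zero>\<^bsub>R\<^esub> \<odot>\<^bsub>M\<^esub> x = \<zero>\<^bsub>R\<^esub> \<odot>\<^bsub>M\<^esub> x"
      using smult_l_distr[of "\<zero>\<^bsub>R\<^esub>" "\<zero>\<^bsub>R\<^esub>" x] assms(2) by simp
    then show "\<zero>\<^bsub>M\<^esub> = \<zero>\<^bsub>R\<^esub> \<odot>\<^bsub>M\<^esub> x"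
      using M.add.l_cancel_one[of "\<zero>\<^bsub>R\<^esub> \<odot>\<^bsub>M\<^esub> x" "\<zero>\<^bsub>R\<^esub> \<odot>\<^bsub>M\<^esub> x"] assms(2) by simp
  qed simp
  have "submodule ?N R M"
  proof (rule submoduleI')
    fix a b assume "a \<in> ?N" "b \<in> ?N"
    then obtain r s where "r \<in> carrier R" "s \<in> carrier R" "a = r \<odot>\<^bsub>M\<^esub> x" "b = s \<odot>\<^bsub>M\<^esub> x"
      by blast
    then show "a \<oplus>\<^bsub>M\<^esub> b \<in> ?N"
      by (intro image_eqI[of _ _ "r \<oplus>\<^bsub>R\<^esub> s"]) (use assms(2) in \<open>auto simp: smult_l_distr\<close>)
  next
    fix a y assume "a \<in> carrier R" "y \<in> ?N"
    then obtain r where "r \<in> carrier R" "y = r \<odot>\<^bsub>M\<^esub> x" by blast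
    then show "a \<odot>\<^bsub>M\<^esub> y \<in> ?N"
      by (intro image_eqI[of _ _ "a \<otimes>\<^bsub>R\<^esub> r"])
         (use assms(2) \<open>a \<in> carrier R\<close> in \<open>auto simp: smult_assoc1\<close>)
  qed (use z assms(2) in auto)
  then show ?thesis using assms x by (auto simp: simple_left_module_def)
qed

context
  fixes R :: "('a, 'r) ring_scheme" and M :: "('a, 'b, 'm) module_scheme" and h :: "'b \<Rightarrow> 'c"
  assumes M: "left_module R M" and h: "inj_on h (carrier M)"
begin

interpretation left_module R M by (rule M)

lemma transport_simps:
  "carrier (transport_module h M) = h ` carrier M"
  "\<zero>\<^bsub>transport_module h M\<^esub> = h \<zero>\<^bsub>M\<^esub>"
  "\<lbrakk>x \<in> carrier M; y \<in> carrier M\<rbrakk> \<Longrightarrow> h x \<oplus>\<^bsub>transport_module h M\<^esub> h y = h (x \<oplus>\<^bsub>M\<^esub> y)"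
  "x \<in> carrier M \<Longrightarrow> r \<odot>\<^bsub>transport_module h M\<^esub> h x = h (r \<odot>\<^bsub>M\<^esub> x)"
  using h by (auto simp: transport_module_def)

lemma transport_left_module: "left_module R (transport_module h M)"
proof -
  have "abelian_group (transport_module h M)"
  proof (rule abelian_groupI)
    fix x assume "x \<in> carrier (transport_module h M)"
    then obtain u where "u \<in> carrier M" "x = h u" by (auto simp: transport_simps)
    then show "\<exists>y\<in>carrier (transport_module h M).
        y \<oplus>\<^bsub>transport_module h M\<^esub> x = \<zero>\<^bsub>transport_module h M\<^esub>"
      by (intro bexI[of _ "h (\<ominus>\<^bsub>M\<^esub> u)"]) (auto simp: transport_simps M.l_neg)
  qed (auto simp: transport_simps M.a_ac)
  then show ?thesis
    by (auto intro!: left_module.intro left_module_axioms.intro R.ring_axioms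
        simp: transport_simps smult_l_distr smult_r_distr smult_assoc1)
qed

lemma transport_simple:
  assumes "simple_left_module R M"
  shows "simple_left_module R (transport_module h M)"
proof -
  let ?T = "transport_module h M"
  interpret T: left_module R ?T by (rule transport_left_module)
  have nz: "carrier ?T \<noteq> {\<zero>\<^bsub>?T\<^esub>}"
  proof
    assume "carrier ?T = {\<zero>\<^bsub>?T\<^esub>}"
    then have "h ` carrier M = h ` {\<zero>\<^bsub>M\<^esub>}" by (simp add: transport_simps)
    then have "carrier M = {\<zero>\<^bsub>M\<^esub>}" using inj_on_image_eq_iff[OF h] by blast
    then show False using assms by (simp add: simple_left_module_def)
  qed
  have "N = {\<zero>\<^bsub>?T\<^esub>} \<or> N = carrier ?T" if N: "submodule N R ?T" for N
  proof -
    define K where "K = {x \<in> carrier M. h x \<in> N}"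
    have sub: "N \<subseteq> h ` carrier M" and z: "h \<zero>\<^bsub>M\<^esub> \<in> N"
      and pl: "\<And>x y. x \<in> N \<Longrightarrow> y \<in> N \<Longrightarrow> x \<oplus>\<^bsub>?T\<^esub> y \<in> N"
      and sm: "\<And>r x. r \<in> carrier R \<Longrightarrow> x \<in> N \<Longrightarrow> r \<odot>\<^bsub>?T\<^esub> x \<in> N"
      using N subgroup.subset[of N "add_monoid ?T"] subgroup.one_closed[of N "add_monoid ?T"]
        subgroup.m_closed[of N "add_monoid ?T"]
      by (auto simp: submodule_def submodule_axioms_def transport_simps)
    have NK: "N = h ` K" using sub by (auto simp: K_def)
    have "submodule K R M"
    proof (rule submoduleI')
      fix a b assume "a \<in> K" "b \<in> K"
      then show "a \<oplus>\<^bsub>M\<^esub> b \<in> K" using pl[of "h a" "h b"] by (auto simp: K_def transport_simps)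
    next
      fix a x assume "a \<in> carrier R" "x \<in> K"
      then show "a \<odot>\<^bsub>M\<^esub> x \<in> K" using sm[of a "h x"] by (auto simp: K_def transport_simps)
    qed (use z in \<open>auto simp: K_def\<close>)
    then have "K = {\<zero>\<^bsub>M\<^esub>} \<or> K = carrier M" using assms by (simp add: simple_left_module_def)
    then show ?thesis using NK by (auto simp: transport_simps)
  qed
  then show ?thesis using nz by (auto simp: simple_left_module_def transport_left_module)
qed

lemma transport_singular:
  assumes "singular_left_module R M"
  shows "singular_left_module R (transport_module h M)"
  unfolding singular_left_module_def
proof (intro conjI ballI transport_left_module)
  fix y assume "y \<in> carrier (transport_module h M)"
  then obtain x where x: "x \<in> carrier M" "y = h x" by (auto simp: transport_simps)
  then obtain L where L: "essential_left_ideal L R" "\<forall>r \<in> L. r \<odot>\<^bsub>M\<^esub> x = \<zero>\<^bsub>M\<^esub>"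
    using assms unfolding singular_left_module_def by blast
  then show "\<exists>L. essential_left_ideal L R \<and>
      (\<forall>r \<in> L. r \<odot>\<^bsub>transport_module h M\<^esub> y = \<zero>\<^bsub>transport_module h M\<^esub>)"
    using x by (intro exI[of _ L]) (simp add: transport_simps)
qed

lemma transport_Wnil_injective:
  assumes "Wnil_injective R (transport_module h M)"
  shows "Wnil_injective R M"
proof -
  let ?T = "transport_module h M"
  let ?k = "inv_into (carrier M) h"
  have push: "(\<lambda>x. h (f x)) \<in> left_ideal_hom R I ?T" if "f \<in> left_ideal_hom R I M" for f I
    using that by (auto simp: left_ideal_hom_def transport_simps Pi_iff)
  have pull: "(\<lambda>x. ?k (f x)) \<in> left_ideal_hom R (carrier R) M"
    if "f \<in> left_ideal_hom R (carrier R) ?T" for f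
  proof -
    have ex: "\<exists>u \<in> carrier M. f x = h u" if "x \<in> carrier R" for x
      using that \<open>f \<in> _\<close> by (auto simp: left_ideal_hom_def transport_simps Pi_iff)
    have k: "?k (f x) \<in> carrier M" "h (?k (f x)) = f x" if "x \<in> carrier R" for x
      using ex[OF that] h by auto
    have "?k (f (x \<oplus>\<^bsub>R\<^esub> y)) = ?k (f x) \<oplus>\<^bsub>M\<^esub> ?k (f y)" if "x \<in> carrier R" "y \<in> carrier R" for x y
    proof -
      have "f (x \<oplus>\<^bsub>R\<^esub> y) = h (?k (f x)) \<oplus>\<^bsub>?T\<^esub> h (?k (f y))"
        using that \<open>f \<in> _\<close> k by (simp add: left_ideal_hom_def)
      also have "\<dots> = h (?k (f x) \<oplus>\<^bsub>M\<^esub> ?k (f y))"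
        using k that by (intro transport_simps) auto
      finally show ?thesis
        using inv_into_f_f[OF h M.a_closed[OF k(1)[OF that(1)] k(1)[OF that(2)]]] by simp
    qed
    moreover have "?k (f (r \<otimes>\<^bsub>R\<^esub> x)) = r \<odot>\<^bsub>M\<^esub> ?k (f x)" if "r \<in> carrier R" "x \<in> carrier R" for r x
    proof -
      have "f (r \<otimes>\<^bsub>R\<^esub> x) = r \<odot>\<^bsub>?T\<^esub> h (?k (f x))"
        using that \<open>f \<in> _\<close> k by (simp add: left_ideal_hom_def)
      also have "\<dots> = h (r \<odot>\<^bsub>M\<^esub> ?k (f x))"
        using k that by (intro transport_simps) auto
      finally show ?thesis
        using inv_into_f_f[OF h smult_closed[OF that(1) k(1)[OF that(2)]]] by simp
    qed
    ultimately show ?thesis using k by (auto simp: left_ideal_hom_def)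
  qed
  show ?thesis
    unfolding Wnil_injective_def
  proof (intro conjI ballI impI M)
    fix w assume w: "w \<in> nilpotents R" "w \<noteq> \<zero>\<^bsub>R\<^esub>"
    have "\<exists>m::nat. m > 0 \<and> w [^]\<^bsub>R\<^esub> m \<noteq> \<zero>\<^bsub>R\<^esub> \<and>
         (\<forall>f \<in> left_ideal_hom R (principal_left_ideal R (w [^]\<^bsub>R\<^esub> m)) ?T.
            \<exists>g \<in> left_ideal_hom R (carrier R) ?T.
              \<forall>x \<in> principal_left_ideal R (w [^]\<^bsub>R\<^esub> m). g x = f x)"
      using assms w by (simp add: Wnil_injective_def)
    then obtain m :: nat where m: "m > 0" "w [^]\<^bsub>R\<^esub> m \<noteq> \<zero>\<^bsub>R\<^esub>"
      and ext: "\<And>f. f \<in> left_ideal_hom R (principal_left_ideal R (w [^]\<^bsub>R\<^esub> m)) ?T \<Longrightarrow>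
            \<exists>g \<in> left_ideal_hom R (carrier R) ?T.
              \<forall>x \<in> principal_left_ideal R (w [^]\<^bsub>R\<^esub> m). g x = f x"
      by auto
    have "\<exists>g \<in> left_ideal_hom R (carrier R) M.
            \<forall>x \<in> principal_left_ideal R (w [^]\<^bsub>R\<^esub> m). g x = f x"
      if f: "f \<in> left_ideal_hom R (principal_left_ideal R (w [^]\<^bsub>R\<^esub> m)) M" for f
    proof -
      obtain g where g: "g \<in> left_ideal_hom R (carrier R) ?T"
        and eq: "\<forall>x \<in> principal_left_ideal R (w [^]\<^bsub>R\<^esub> m). g x = h (f x)"
        using ext[OF push[OF f]] by blast
      have "?k (g x) = f x" if "x \<in> principal_left_ideal R (w [^]\<^bsub>R\<^esub> m)" for x
        using that eq f h by (auto simp: left_ideal_hom_def Pi_iff)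
      then show ?thesis by (intro bexI[OF _ pull[OF g]] ballI)
    qed
    then show "\<exists>m::nat. m > 0 \<and> w [^]\<^bsub>R\<^esub> m \<noteq> \<zero>\<^bsub>R\<^esub> \<and>
         (\<forall>f \<in> left_ideal_hom R (principal_left_ideal R (w [^]\<^bsub>R\<^esub> m)) M.
            \<exists>g \<in> left_ideal_hom R (carrier R) M.
              \<forall>x \<in> principal_left_ideal R (w [^]\<^bsub>R\<^esub> m). g x = f x)"
      using m by (intro exI[of _ m]) simp
  qed
qed

end

theorem simple_singular_Wnil_injective_any_type:
  fixes R :: "('a, 'r) ring_scheme" and M :: "('a, 'b, 'm) module_scheme"
  assumes "simple_singular_modules_Wnil_injective R"
    and simple: "simple_left_module R M" and singular: "singular_left_module R M"
  shows "Wnil_injective R M"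
proof -
  interpret left_module R M using simple by (simp add: simple_left_module_def)
  obtain x where x: "x \<in> carrier M" "x \<noteq> \<zero>\<^bsub>M\<^esub>"
  proof -
    have "carrier M \<noteq> {\<zero>\<^bsub>M\<^esub>}" using simple by (simp add: simple_left_module_def)
    then show ?thesis using that M.zero_closed by blast
  qed
  define h where "h = (\<lambda>y. {r \<in> carrier R. r \<odot>\<^bsub>M\<^esub> x = y})"
  have "inj_on h (carrier M)"
  proof (rule inj_onI)
    fix y z assume "y \<in> carrier M" and eq: "h y = h z"
    then have "y \<in> (\<lambda>r. r \<odot>\<^bsub>M\<^esub> x) ` carrier R"
      by (simp only: simple_left_module_generated[OF simple x])
    then obtain r where "r \<in> carrier R" "y = r \<odot>\<^bsub>M\<^esub> x" by (rule imageE)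
    then have "r \<in> h y" by (simp add: h_def)
    then have "r \<in> h z" by (simp only: eq)
    then show "y = z" using \<open>y = r \<odot>\<^bsub>M\<^esub> x\<close> by (simp add: h_def)
  qed
  note tr = left_module_axioms this
  have "Wnil_injective R (transport_module h M)"
    using assms(1) transport_simple[OF tr simple] transport_singular[OF tr singular]
    by (simp add: simple_singular_modules_Wnil_injective_def)
  then show ?thesis by (rule transport_Wnil_injective[OF tr])
qed

end

theory Submission
  imports Defs
begin

text \<open>
  If \<open>R\<close> is not reduced, there is \<open>a \<noteq> 0\<close> with \<open>a\<^sup>2 = 0\<close>; then \<open>l(a)\<close> is a proper two-sided
  ideal containing \<open>aR\<close>. In the semiprime case \<open>l(a) \<inter> r(l(a))\<close> is an ideal of square zero
  containing \<open>a\<close>. In the other cases take a maximal left ideal \<open>L \<supseteq> l(a)\<close>. If \<open>L\<close> is not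
  essential, then \<open>L \<subseteq> l(e)\<close> for a nonzero idempotent \<open>e\<close> with \<open>Re\<close> minimal; now \<open>aRe = 0\<close>,
  so \<open>ea = 0\<close> by hypothesis, and \<open>e \<in> l(a) \<subseteq> l(e)\<close> gives \<open>e = 0\<close>. If \<open>L\<close> is essential, then
  \<open>R/L\<close> is simple and singular, and extending \<open>ra \<mapsto> r + L\<close> from \<open>Ra\<close> to \<open>R\<close> yields \<open>c\<close> with
  \<open>1 - ac \<in> L\<close>; as \<open>ac \<in> l(a) \<subseteq> L\<close>, this is a contradiction.
\<close>

text \<open>Properness is expressed as \<open>\<one> \<notin> L\<close>, a condition that survives
  unions of chains and is directly what the final contradiction refutes.\<close>

definition maximal_left_ideal :: "'a set \<Rightarrow> ('a, 'r) ring_scheme \<Rightarrow> bool" where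
  "maximal_left_ideal L R \<longleftrightarrow> left_ideal L R \<and> \<one>\<^bsub>R\<^esub> \<notin> L \<and>
     (\<forall>J. left_ideal J R \<and> L \<subseteq> J \<and> \<one>\<^bsub>R\<^esub> \<notin> J \<longrightarrow> J = L)"

text \<open>The module R/L on cosets, whose element type is the one over which
  \<open>simple_singular_modules_Wnil_injective\<close> quantifies. The union in
  \<open>smult\<close> avoids choosing a representative of the coset; for a left ideal
  \<open>L\<close> all its members coincide.\<close>

definition quotient_left_module ::
  "('a, 'r) ring_scheme \<Rightarrow> 'a set \<Rightarrow> ('a, 'a set) module" where
  "quotient_left_module R L = \<lparr>carrier = a_rcosets\<^bsub>R\<^esub> L,
     mult = (\<lambda>X Y. undefined), one = undefined, zero = L,
     add = (\<lambda>X Y. X <+>\<^bsub>R\<^esub> Y),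
     smult = (\<lambda>r X. \<Union>x\<in>X. L +>\<^bsub>R\<^esub> (r \<otimes>\<^bsub>R\<^esub> x))\<rparr>"

context ring
begin

section \<open>Elementary constructions of left ideals\<close>

lemma left_idealI:
  assumes "I \<subseteq> carrier R" "\<zero> \<in> I"
    and "\<And>x y. \<lbrakk>x \<in> I; y \<in> I\<rbrakk> \<Longrightarrow> x \<oplus> y \<in> I"
    and mult: "\<And>r x. \<lbrakk>r \<in> carrier R; x \<in> I\<rbrakk> \<Longrightarrow> r \<otimes> x \<in> I"
  shows "left_ideal I R"
proof -
  \<comment> \<open>Additive inverses are obtained as multiples by
    \<open>\<ominus> \<one>\<close>.\<close>
  have "\<ominus> x \<in> I" if "x \<in> I" for x
    using mult[of "\<ominus> \<one>" x] that assms(1) by (auto simp: l_minus)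
  then have "additive_subgroup I R"
    using assms by (auto intro!: additive_subgroup.intro subgroup.intro simp flip: a_inv_def)
  then show ?thesis using mult by (simp add: left_ideal_def)
qed

lemma left_idealD:
  assumes "left_ideal I R"
  shows "additive_subgroup I R" "I \<subseteq> carrier R" "\<zero> \<in> I"
    and "\<And>x y. \<lbrakk>x \<in> I; y \<in> I\<rbrakk> \<Longrightarrow> x \<oplus> y \<in> I"
    and "\<And>x y. \<lbrakk>x \<in> I; y \<in> I\<rbrakk> \<Longrightarrow> x \<ominus> y \<in> I"
    and "\<And>r x. \<lbrakk>r \<in> carrier R; x \<in> I\<rbrakk> \<Longrightarrow> r \<otimes> x \<in> I"
proof -
  show I: "additive_subgroup I R" using assms by (simp add: left_ideal_def)
  interpret additive_subgroup I R by (rule I)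
  show "I \<subseteq> carrier R" "\<zero> \<in> I" by (auto simp: a_subset)
  show "\<And>x y. \<lbrakk>x \<in> I; y \<in> I\<rbrakk> \<Longrightarrow> x \<oplus> y \<in> I" by simp
  show "\<And>x y. \<lbrakk>x \<in> I; y \<in> I\<rbrakk> \<Longrightarrow> x \<ominus> y \<in> I" by (simp add: a_minus_def)
  show "\<And>r x. \<lbrakk>r \<in> carrier R; x \<in> I\<rbrakk> \<Longrightarrow> r \<otimes> x \<in> I"
    using assms by (simp add: left_ideal_def)
qed

lemma left_ideal_one_iff: "left_ideal I R \<Longrightarrow> \<one> \<in> I \<longleftrightarrow> I = carrier R"
proof
  assume I: "left_ideal I R" and "\<one> \<in> I"
  have "x \<in> I" if "x \<in> carrier R" for x
    using left_idealD(6)[OF I that \<open>\<one> \<in> I\<close>] that by simp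
  then show "I = carrier R" using left_idealD(2)[OF I] by blast
qed simp

lemma left_ideal_set_add:
  assumes I: "left_ideal I R" and J: "left_ideal J R"
  shows "left_ideal (I <+>\<^bsub>R\<^esub> J) R"
proof -
  note D = left_idealD[OF I] left_idealD[OF J]
  have eq: "I <+>\<^bsub>R\<^esub> J = {x \<oplus> y | x y. x \<in> I \<and> y \<in> J}"
    by (auto simp: set_add_def')
  show ?thesis unfolding eq
  proof (rule left_idealI)
    show "{x \<oplus> y | x y. x \<in> I \<and> y \<in> J} \<subseteq> carrier R" using D(2,8) by auto
    show "\<zero> \<in> {x \<oplus> y | x y. x \<in> I \<and> y \<in> J}" using D(3,9) by force
  next
    fix u v
    assume "u \<in> {x \<oplus> y | x y. x \<in> I \<and> y \<in> J}" "v \<in> {x \<oplus> y | x y. x \<in> I \<and> y \<in> J}"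
    then obtain x y x' y' where xy: "x \<in> I" "y \<in> J" "x' \<in> I" "y' \<in> J"
      "u = x \<oplus> y" "v = x' \<oplus> y'"
      by blast
    moreover have "x \<in> carrier R" "y \<in> carrier R" "x' \<in> carrier R" "y' \<in> carrier R"
      using xy D(2,8) by auto
    ultimately have "u \<oplus> v = (x \<oplus> x') \<oplus> (y \<oplus> y')" by (simp add: a_ac)
    then show "u \<oplus> v \<in> {x \<oplus> y | x y. x \<in> I \<and> y \<in> J}" using xy D(4,10) by blast
  next
    fix r u
    assume r: "r \<in> carrier R" and "u \<in> {x \<oplus> y | x y. x \<in> I \<and> y \<in> J}"
    then obtain x y where xy: "x \<in> I" "y \<in> J" "u = x \<oplus> y" by blast
    then have "r \<otimes> u = r \<otimes> x \<oplus> r \<otimes> y" using D(2,8) r by (simp add: r_distr subset_iff)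
    then show "r \<otimes> u \<in> {x \<oplus> y | x y. x \<in> I \<and> y \<in> J}" using xy r D(6,12) by blast
  qed
qed

text \<open>This set is the annihilator of the coset of \<open>x\<close> in R/J, which is how it
  enters the proof that quotients are singular.\<close>

lemma left_ideal_preimage:
  assumes J: "left_ideal J R" and x: "x \<in> carrier R"
  shows "left_ideal {r \<in> carrier R. r \<otimes> x \<in> J} R"
  using left_idealD[OF J] x by (intro left_idealI) (auto simp: l_distr m_assoc)

lemma left_ideal_image:
  assumes J: "left_ideal J R" and x: "x \<in> carrier R"
  shows "left_ideal ((\<lambda>r. r \<otimes> x) ` J) R"
proof (rule left_idealI)
  note D = left_idealD[OF J]
  show "(\<lambda>r. r \<otimes> x) ` J \<subseteq> carrier R" using D(2) x by auto
  show "\<zero> \<in> (\<lambda>r. r \<otimes> x) ` J" using D(3) x by (intro image_eqI[of _ _ \<zero>]) auto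
next
  note D = left_idealD[OF J]
  fix u v assume "u \<in> (\<lambda>r. r \<otimes> x) ` J" "v \<in> (\<lambda>r. r \<otimes> x) ` J"
  then obtain r s where rs: "r \<in> J" "s \<in> J" "u = r \<otimes> x" "v = s \<otimes> x" by blast
  then have "u \<oplus> v = (r \<oplus> s) \<otimes> x" using D(2) x by (simp add: l_distr subset_iff)
  then show "u \<oplus> v \<in> (\<lambda>r. r \<otimes> x) ` J" using D(4) rs by blast
next
  note D = left_idealD[OF J]
  fix r u assume r: "r \<in> carrier R" and "u \<in> (\<lambda>r. r \<otimes> x) ` J"
  then obtain s where s: "s \<in> J" "u = s \<otimes> x" by blast
  then have "r \<otimes> u = (r \<otimes> s) \<otimes> x" using D(2) r x by (simp add: m_assoc subset_iff)
  then show "r \<otimes> u \<in> (\<lambda>r. r \<otimes> x) ` J" using D(6) s r by blast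
qed

lemma left_ideal_left_annihilator:
  "a \<in> carrier R \<Longrightarrow> left_ideal (left_annihilator R a) R"
  by (rule left_idealI) (auto simp: left_annihilator_def l_distr m_assoc)

section \<open>Maximal and essential left ideals\<close>

lemma exists_maximal_left_ideal:
  assumes L: "left_ideal L R" "\<one> \<notin> L"
  obtains J where "maximal_left_ideal J R" "L \<subseteq> J"
proof -
  let ?S = "{J. left_ideal J R \<and> L \<subseteq> J \<and> \<one> \<notin> J}"
  have "\<exists>J\<in>?S. \<forall>K\<in>?S. J \<subseteq> K \<longrightarrow> K = J"
  proof (rule subset_Zorn_nonempty)
    show "?S \<noteq> {}" using L by blast
  next
    fix C assume ne: "C \<noteq> {}" and chain: "subset.chain ?S C"
    have C: "\<And>J. J \<in> C \<Longrightarrow> left_ideal J R \<and> L \<subseteq> J \<and> \<one> \<notin> J"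
      and tot: "\<And>I J. I \<in> C \<Longrightarrow> J \<in> C \<Longrightarrow> I \<subseteq> J \<or> J \<subseteq> I"
      using chain by (auto simp: subset_chain_def)
    \<comment> \<open>The union is the upper bound demanded by Zorn's lemma. For sums, comparability
      puts both summands into a single member of the chain.\<close>
    have "left_ideal (\<Union>C) R"
    proof (rule left_idealI)
      show "\<Union>C \<subseteq> carrier R" using C left_idealD(2) by blast
      show "\<zero> \<in> \<Union>C" using C ne left_idealD(3) by blast
      show "x \<oplus> y \<in> \<Union>C" if "x \<in> \<Union>C" "y \<in> \<Union>C" for x y
      proof -
        obtain I J where "I \<in> C" "J \<in> C" "x \<in> I" "y \<in> J" using \<open>x \<in> \<Union>C\<close> \<open>y \<in> \<Union>C\<close> by blast
        then obtain K where "K \<in> C" "x \<in> K" "y \<in> K" using tot by blast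
        then show ?thesis using C left_idealD(4) by blast
      qed
      show "r \<otimes> x \<in> \<Union>C" if "r \<in> carrier R" "x \<in> \<Union>C" for r x
        using that C left_idealD(6) by blast
    qed
    then show "\<Union>C \<in> ?S" using C ne by blast
  qed
  then obtain J where J: "left_ideal J R" "L \<subseteq> J" "\<one> \<notin> J"
    and max: "\<forall>K\<in>?S. J \<subseteq> K \<longrightarrow> K = J"
    by (elim bexE CollectE conjE)
  have "K = J" if "left_ideal K R" "J \<subseteq> K" "\<one> \<notin> K" for K
    using bspec[OF max, of K] that subset_trans[OF J(2) that(2)] by simp
  then show ?thesis using that[of J] J by (simp add: maximal_left_ideal_def)
qed

text \<open>The sum L + J is a left ideal strictly containing \<open>L\<close>, so by maximality it
  contains \<open>\<one>\<close> and hence is the whole ring.\<close>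

lemma maximal_left_ideal_set_add:
  assumes L: "maximal_left_ideal L R" and J: "left_ideal J R" "\<not> J \<subseteq> L"
    and x: "x \<in> carrier R"
  obtains m j where "m \<in> L" "j \<in> J" "x = m \<oplus> j"
proof -
  have L': "left_ideal L R" using L by (simp add: maximal_left_ideal_def)
  note D = left_idealD[OF L'] left_idealD[OF J(1)]
  have S: "left_ideal (L <+>\<^bsub>R\<^esub> J) R" by (rule left_ideal_set_add[OF L' J(1)])
  have "L \<subseteq> L <+>\<^bsub>R\<^esub> J"
  proof
    fix y assume "y \<in> L"
    then have "y = y \<oplus> \<zero>" using D(2) by auto
    then show "y \<in> L <+>\<^bsub>R\<^esub> J" using \<open>y \<in> L\<close> D(9) unfolding set_add_def' by blast
  qed
  moreover have "J \<subseteq> L <+>\<^bsub>R\<^esub> J"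
  proof
    fix y assume "y \<in> J"
    then have "y = \<zero> \<oplus> y" using D(8) by auto
    then show "y \<in> L <+>\<^bsub>R\<^esub> J" using \<open>y \<in> J\<close> D(3) unfolding set_add_def' by blast
  qed
  ultimately have "\<one> \<in> L <+>\<^bsub>R\<^esub> J"
    using L S J(2) unfolding maximal_left_ideal_def by blast
  then have "x \<in> L <+>\<^bsub>R\<^esub> J" using left_ideal_one_iff[OF S] x by simp
  then show ?thesis using that unfolding set_add_def' by blast
qed

text \<open>A nonzero \<open>J\<close> with zero intersection with \<open>L\<close> is a complement
  of \<open>L\<close>, since \<open>L\<close> is maximal. The component of \<open>\<one>\<close> in
  \<open>J\<close> is an idempotent that generates \<open>J\<close> and is annihilated by
  \<open>L\<close> from the left.\<close>

lemma maximal_left_ideal_not_essential: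
  assumes L: "maximal_left_ideal L R" and ness: "\<not> essential_left_ideal L R"
  obtains e where "e \<in> left_minimal_idempotents R" "e \<noteq> \<zero>" "L \<subseteq> left_annihilator R e"
proof -
  have L': "left_ideal L R" using L by (simp add: maximal_left_ideal_def)
  obtain J where J: "left_ideal J R" "J \<noteq> {\<zero>}" and LJ: "L \<inter> J = {\<zero>}"
    using ness L' unfolding essential_left_ideal_def by blast
  note D = left_idealD[OF L'] left_idealD[OF J(1)]
  \<comment> \<open>A part of \<open>J\<close> inside \<open>L\<close> lies in the zero
    intersection, so every nonzero left ideal below \<open>J\<close> also complements
    \<open>L\<close>.\<close>
  have nsub: "\<not> K \<subseteq> L" if "left_ideal K R" "K \<noteq> {\<zero>}" "K \<subseteq> J" for K
    using that LJ left_idealD(3)[OF that(1)] by blast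
  obtain m e where me: "m \<in> L" "e \<in> J" "\<one> = m \<oplus> e"
    using maximal_left_ideal_set_add[OF L J(1) nsub[OF J subset_refl] one_closed] .
  have c: "m \<in> carrier R" "e \<in> carrier R" using me D(2,8) by blast+
  have split: "x = x \<otimes> m \<oplus> x \<otimes> e" if "x \<in> carrier R" for x
    using r_distr[OF c that] that by (simp flip: me(3))
  \<comment> \<open>The element xe = x - xm lies in \<open>L\<close> because \<open>x\<close> and
    \<open>m\<close> do, and in \<open>J\<close> because \<open>e\<close> does.\<close>
  have ann: "x \<otimes> e = \<zero>" if "x \<in> L" for x
  proof -
    have x: "x \<in> carrier R" using that D(2,8) by blast
    have "x \<otimes> e = x \<ominus> x \<otimes> m"
      using split[OF x] x c by (metis a_comm add.inv_solve_right' m_closed minus_eq)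
    then have "x \<otimes> e \<in> L \<inter> J"
      using D(5)[OF that D(6)[OF x me(1)]] D(12)[OF x me(2)] by simp
    then show ?thesis using LJ by simp
  qed
  \<comment> \<open>Symmetrically, xm = x - xe lies in both \<open>L\<close> and \<open>J\<close>,
    so it vanishes. Applied to \<open>e\<close> itself this yields idempotence.\<close>
  have right_id: "x \<otimes> e = x" if "x \<in> J" for x
  proof -
    have x: "x \<in> carrier R" using that D(2,8) by blast
    have "x \<otimes> m = x \<ominus> x \<otimes> e"
      using split[OF x] x c by (metis add.inv_solve_right' m_closed minus_eq)
    then have "x \<otimes> m \<in> L \<inter> J"
      using D(11)[OF that D(12)[OF x me(2)]] D(6)[OF x me(1)] by simp
    then show ?thesis using LJ split[OF x] x c by simp
  qed
  have Re: "principal_left_ideal R e = J"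
    using right_id D(8,12) me(2) unfolding principal_left_ideal_def by force
  have "K = {\<zero>} \<or> K = J" if K: "left_ideal K R" "K \<subseteq> J" for K
  proof (rule disjCI)
    assume "K \<noteq> J"
    show "K = {\<zero>}"
    proof (rule ccontr)
      assume nz: "K \<noteq> {\<zero>}"
      \<comment> \<open>Modular law: in x = u + k with \<open>u\<close> in \<open>L\<close> and
        \<open>k\<close> in \<open>K\<close>, the difference u = x - k also lies in
        \<open>J\<close>, so u = 0.\<close>
      have "x \<in> K" if x: "x \<in> J" for x
      proof -
        obtain u k where uk: "u \<in> L" "k \<in> K" "x = u \<oplus> k"
          using maximal_left_ideal_set_add[OF L K(1) nsub[OF K(1) nz K(2)], of x] x D(8) by blast
        have c: "u \<in> carrier R" "k \<in> carrier R" using uk K(2) D(2,8) by blast+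
        then have "u = x \<ominus> k"
          using uk(3) by (metis add.inv_solve_right' add.m_closed minus_eq)
        then have "u \<in> L \<inter> J" using uk(1) D(11)[OF x subsetD[OF K(2) uk(2)]] by simp
        then show ?thesis using LJ uk c by simp
      qed
      then show False using K(2) \<open>K \<noteq> J\<close> by blast
    qed
  qed
  then have "e \<in> left_minimal_idempotents R"
    using c right_id[OF me(2)] J
    by (simp add: left_minimal_idempotents_def idempotents_def minimal_left_ideal_def Re)
  moreover have "e \<noteq> \<zero>"
  proof
    assume "e = \<zero>"
    then have "x = \<zero>" if "x \<in> J" for x using right_id[OF that] subsetD[OF D(8) that] by simp
    then show False using J(2) D(9) by blast
  qed
  moreover have "L \<subseteq> left_annihilator R e" using ann D(2) by (auto simp: left_annihilator_def)
  ultimately show ?thesis by (rule that)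
qed

text \<open>Given a nonzero left ideal \<open>J\<close>, either Jx = 0 and \<open>J\<close> lies in
  the preimage, or \<open>L\<close> meets the nonzero left ideal Jx in some rx \<noteq> 0, and then
  \<open>r\<close> is a nonzero common element.\<close>

lemma essential_left_ideal_preimage:
  assumes L: "essential_left_ideal L R" and x: "x \<in> carrier R"
  shows "essential_left_ideal {r \<in> carrier R. r \<otimes> x \<in> L} R"
proof -
  have L': "left_ideal L R" using L by (simp add: essential_left_ideal_def)
  have "{r \<in> carrier R. r \<otimes> x \<in> L} \<inter> J \<noteq> {\<zero>}" if J: "left_ideal J R" "J \<noteq> {\<zero>}" for J
  proof -
    note D = left_idealD[OF J(1)]
    show ?thesis
    proof (cases "(\<lambda>r. r \<otimes> x) ` J = {\<zero>}")
      case True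
      then have "r \<otimes> x \<in> L" if "r \<in> J" for r
        using imageI[OF that, of "\<lambda>r. r \<otimes> x"] left_idealD(3)[OF L'] by simp
      then show ?thesis using J D(2) by blast
    next
      case False
      then have "L \<inter> (\<lambda>r. r \<otimes> x) ` J \<noteq> {\<zero>}"
        using L left_ideal_image[OF J(1) x] unfolding essential_left_ideal_def by blast
      moreover have "\<zero> \<in> L \<inter> (\<lambda>r. r \<otimes> x) ` J"
        using left_idealD(3)[OF L'] left_idealD(3)[OF left_ideal_image[OF J(1) x]] by blast
      ultimately obtain r where "r \<in> J" "r \<otimes> x \<in> L" "r \<otimes> x \<noteq> \<zero>" by blast
      moreover have "r \<noteq> \<zero>" using calculation x by auto
      ultimately show ?thesis using D(2) by blast
    qed
  qed
  then show ?thesis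
    using left_ideal_preimage[OF L' x] by (simp add: essential_left_ideal_def)
qed

section \<open>Quotients of the ring by a left ideal\<close>

lemma quotient_left_module_simps:
  assumes L: "left_ideal L R"
  shows "carrier (quotient_left_module R L) = (\<lambda>x. L +> x) ` carrier R"
    and "\<zero>\<^bsub>quotient_left_module R L\<^esub> = L +> \<zero>"
    and "\<lbrakk>x \<in> carrier R; y \<in> carrier R\<rbrakk> \<Longrightarrow>
      (L +> x) \<oplus>\<^bsub>quotient_left_module R L\<^esub> (L +> y) = L +> (x \<oplus> y)"
    and "\<lbrakk>r \<in> carrier R; x \<in> carrier R\<rbrakk> \<Longrightarrow>
      r \<odot>\<^bsub>quotient_left_module R L\<^esub> (L +> x) = L +> (r \<otimes> x)"
    and coset_eq_iff: "\<lbrakk>x \<in> carrier R; y \<in> carrier R\<rbrakk> \<Longrightarrow> L +> x = L +> y \<longleftrightarrow> x \<ominus> y \<in> L"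
proof -
  note D = left_idealD[OF L]
  interpret abelian_subgroup L R
    by (rule abelian_subgroupI3[OF D(1) abelian_group_axioms])
  show iff: "L +> x = L +> y \<longleftrightarrow> x \<ominus> y \<in> L" if "x \<in> carrier R" "y \<in> carrier R" for x y
    using that a_rcos_module_minus[OF ring_axioms, of y x] a_repr_independence' a_rcos_self
    by metis
  show "carrier (quotient_left_module R L) = (\<lambda>x. L +> x) ` carrier R"
    by (auto simp: quotient_left_module_def A_RCOSETS_def')
  show "\<zero>\<^bsub>quotient_left_module R L\<^esub> = L +> \<zero>"
    by (simp add: quotient_left_module_def D(2))
  show "(L +> x) \<oplus>\<^bsub>quotient_left_module R L\<^esub> (L +> y) = L +> (x \<oplus> y)"
    if "x \<in> carrier R" "y \<in> carrier R"
    using that by (simp add: quotient_left_module_def a_rcos_sum)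
  show "r \<odot>\<^bsub>quotient_left_module R L\<^esub> (L +> x) = L +> (r \<otimes> x)"
    if r: "r \<in> carrier R" and x: "x \<in> carrier R"
  proof -
    \<comment> \<open>Independence of the representative: y - x in \<open>L\<close> gives ry - rx =
      r(y - x) in \<open>L\<close>, as \<open>L\<close> is a left ideal. The union defining
      \<open>smult\<close> thus runs over a constant nonempty family.\<close>
    have *: "L +> (r \<otimes> y) = L +> (r \<otimes> x)" if y: "y \<in> L +> x" for y
    proof -
      have yc: "y \<in> carrier R" using y x a_r_coset_subset_G[OF D(2) x] by blast
      have "y \<ominus> x \<in> L" using y yc x a_rcos_module_minus[OF ring_axioms] by blast
      then have "r \<otimes> (y \<ominus> x) \<in> L" using D(6) r by blast
      then have "r \<otimes> y \<ominus> r \<otimes> x \<in> L" using r x yc by (simp add: a_minus_def r_distr r_minus)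
      then show ?thesis using iff r x yc by simp
    qed
    have "(\<Union>y\<in>L +> x. L +> (r \<otimes> y)) = (\<Union>y\<in>L +> x. L +> (r \<otimes> x))"
      by (rule SUP_cong[OF refl *])
    also have "\<dots> = L +> (r \<otimes> x)" using a_rcos_self[OF x] by blast
    finally show ?thesis by (simp add: quotient_left_module_def)
  qed
qed

lemma left_module_quotient:
  assumes L: "left_ideal L R"
  shows "left_module R (quotient_left_module R L)"
proof -
  note S = quotient_left_module_simps(1-4)[OF L]
  have "abelian_group (quotient_left_module R L)"
  proof (rule abelian_groupI)
    fix X assume "X \<in> carrier (quotient_left_module R L)"
    then obtain x where "x \<in> carrier R" "X = L +> x" by (auto simp: S)
    then show "\<exists>Y\<in>carrier (quotient_left_module R L).
        Y \<oplus>\<^bsub>quotient_left_module R L\<^esub> X = \<zero>\<^bsub>quotient_left_module R L\<^esub>"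
      by (intro bexI[of _ "L +> (\<ominus> x)"]) (auto simp: S l_neg)
  qed (auto simp: S a_ac)
  then show ?thesis
    by (auto intro!: left_module.intro left_module_axioms.intro ring_axioms
        simp: S l_distr r_distr m_assoc)
qed

text \<open>Submodules of R/L pull back to left ideals containing \<open>L\<close>, and maximality
  leaves only \<open>L\<close> and the whole ring.\<close>

lemma simple_left_module_quotient:
  assumes L: "maximal_left_ideal L R"
  shows "simple_left_module R (quotient_left_module R L)"
proof -
  let ?Q = "quotient_left_module R L"
  have L': "left_ideal L R" and L1: "\<one> \<notin> L" using L by (simp_all add: maximal_left_ideal_def)
  note D = left_idealD[OF L']
  note S = quotient_left_module_simps(1-4)[OF L']
  note iff = coset_eq_iff[OF L']
  have mem: "L +> x = L +> \<zero> \<longleftrightarrow> x \<in> L" if "x \<in> carrier R" for x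
    using iff[of x \<zero>] that by (simp add: a_minus_def)
  have "carrier ?Q \<noteq> {\<zero>\<^bsub>?Q\<^esub>}"
  proof
    assume "carrier ?Q = {\<zero>\<^bsub>?Q\<^esub>}"
    then have "L +> \<one> = L +> \<zero>" using imageI[OF one_closed, of "\<lambda>x. L +> x"] S(1,2) by simp
    then show False using mem[of \<one>] L1 by simp
  qed
  moreover have "N = {\<zero>\<^bsub>?Q\<^esub>} \<or> N = carrier ?Q" if N: "submodule N R ?Q" for N
  proof -
    define K where "K = {x \<in> carrier R. L +> x \<in> N}"
    have sub: "N \<subseteq> carrier ?Q" and z: "L +> \<zero> \<in> N"
      and pl: "\<And>x y. x \<in> N \<Longrightarrow> y \<in> N \<Longrightarrow> x \<oplus>\<^bsub>?Q\<^esub> y \<in> N"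
      and sm: "\<And>r x. r \<in> carrier R \<Longrightarrow> x \<in> N \<Longrightarrow> r \<odot>\<^bsub>?Q\<^esub> x \<in> N"
      using N subgroup.subset[of N "add_monoid ?Q"] subgroup.one_closed[of N "add_monoid ?Q"]
        subgroup.m_closed[of N "add_monoid ?Q"]
      by (auto simp: submodule_def submodule_axioms_def S(2))
    have NK: "N = (\<lambda>x. L +> x) ` K" using sub by (auto simp: K_def S(1))
    have K: "left_ideal K R"
    proof (rule left_idealI)
      fix x y assume "x \<in> K" "y \<in> K"
      then show "x \<oplus> y \<in> K" using pl[of "L +> x" "L +> y"] by (auto simp: K_def S)
    next
      fix r x assume "r \<in> carrier R" "x \<in> K"
      then show "r \<otimes> x \<in> K" using sm[of r "L +> x"] by (auto simp: K_def S)
    qed (use z in \<open>auto simp: K_def\<close>)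
    have LK: "L \<subseteq> K"
    proof
      fix x assume "x \<in> L"
      then have "x \<in> carrier R" "L +> x = L +> \<zero>" using D(2) mem by auto
      then show "x \<in> K" using z by (simp add: K_def)
    qed
    show ?thesis
    proof (cases "\<one> \<in> K")
      case True
      then have "K = carrier R" using left_ideal_one_iff[OF K] by simp
      then show ?thesis using NK S(1) by simp
    next
      case False
      then have "K = L" using L K LK unfolding maximal_left_ideal_def by blast
      then have "N \<subseteq> {L +> \<zero>}" using NK mem D(2) by auto
      then show ?thesis using z S(2) by auto
    qed
  qed
  ultimately show ?thesis
    using left_module_quotient[OF L'] by (simp add: simple_left_module_def)
qed

text \<open>The coset of \<open>x\<close> is annihilated by all \<open>r\<close> with rx in
  \<open>L\<close>, and these form an essential left ideal.\<close>

lemma singular_left_module_quotient: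
  assumes L: "essential_left_ideal L R"
  shows "singular_left_module R (quotient_left_module R L)"
proof -
  have L': "left_ideal L R" using L by (simp add: essential_left_ideal_def)
  note S = quotient_left_module_simps(1-4)[OF L']
  show ?thesis
    unfolding singular_left_module_def
  proof (intro conjI ballI left_module_quotient L')
    fix X assume "X \<in> carrier (quotient_left_module R L)"
    then obtain x where x: "x \<in> carrier R" "X = L +> x" by (auto simp: S)
    have "r \<odot>\<^bsub>quotient_left_module R L\<^esub> X = \<zero>\<^bsub>quotient_left_module R L\<^esub>"
      if "r \<in> carrier R" "r \<otimes> x \<in> L" for r
      using that x coset_eq_iff[OF L', of "r \<otimes> x" \<zero>] by (simp add: S a_minus_def)
    then show "\<exists>I. essential_left_ideal I R \<and>
        (\<forall>r\<in>I. r \<odot>\<^bsub>quotient_left_module R L\<^esub> X = \<zero>\<^bsub>quotient_left_module R L\<^esub>)"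
      using essential_left_ideal_preimage[OF L x(1)] by blast
  qed
qed

text \<open>The map ra \<mapsto> r + L on Ra extends to some \<open>g\<close>. Writing
  \<open>g \<one>\<close> as c + L, the value at \<open>a\<close> is both 1 + L and ac + L.\<close>

lemma Wnil_injective_quotient_divides:
  assumes L: "left_ideal L R" and W: "Wnil_injective R (quotient_left_module R L)"
    and a: "a \<in> carrier R" "a \<noteq> \<zero>" "a \<otimes> a = \<zero>" and ann: "left_annihilator R a \<subseteq> L"
  obtains c where "c \<in> carrier R" "\<one> \<ominus> a \<otimes> c \<in> L"
proof -
  let ?Q = "quotient_left_module R L"
  note S = quotient_left_module_simps(1-4)[OF L]
  have pow2: "a [^] (2::nat) = \<zero>" using a by (simp add: numeral_2_eq_2)
  have "a \<in> nilpotents R" using a pow2 by (auto simp: nilpotents_def intro!: exI[of _ "2::nat"])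
  then have "\<exists>m::nat. m > 0 \<and> a [^] m \<noteq> \<zero> \<and>
         (\<forall>f \<in> left_ideal_hom R (principal_left_ideal R (a [^] m)) ?Q.
            \<exists>g \<in> left_ideal_hom R (carrier R) ?Q.
              \<forall>x \<in> principal_left_ideal R (a [^] m). g x = f x)"
    using W a(2) unfolding Wnil_injective_def by blast
  then obtain m :: nat where m: "m > 0" "a [^] m \<noteq> \<zero>"
    and ext: "\<forall>f \<in> left_ideal_hom R (principal_left_ideal R (a [^] m)) ?Q.
            \<exists>g \<in> left_ideal_hom R (carrier R) ?Q.
              \<forall>x \<in> principal_left_ideal R (a [^] m). g x = f x"
    by blast
  \<comment> \<open>Wnil-injectivity only provides some exponent with a nonzero power; since the
    square of \<open>a\<close> is zero, that exponent is 1 and the extension property concerns Ra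
    itself.\<close>
  have "m = 1"
  proof (rule ccontr)
    assume "m \<noteq> 1"
    then have "m = 2 + (m - 2)" using m(1) by simp
    then have "a [^] m = a [^] (2::nat) \<otimes> a [^] (m - 2)" using nat_pow_mult a(1) by metis
    then show False using m(2) pow2 a(1) by simp
  qed
  then have pa: "a [^] m = a" using a(1) by simp
  let ?P = "principal_left_ideal R a"
  \<comment> \<open>The coefficient of a multiple of \<open>a\<close> is chosen arbitrarily. Two
    choices differ by an element of \<open>left_annihilator R a\<close>, hence of \<open>L\<close>,
    so the coset is well defined.\<close>
  define f where "f = (\<lambda>x. L +> (SOME r. r \<in> carrier R \<and> x = r \<otimes> a))"
  have f: "f (r \<otimes> a) = L +> r" if r: "r \<in> carrier R" for r
  proof -
    define s where "s = (SOME s. s \<in> carrier R \<and> r \<otimes> a = s \<otimes> a)"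
    have "s \<in> carrier R \<and> r \<otimes> a = s \<otimes> a"
      unfolding s_def by (rule someI[of _ r]) (use r in simp)
    then have s: "s \<in> carrier R" "s \<otimes> a = r \<otimes> a" by simp_all
    then have "(s \<ominus> r) \<otimes> a = \<zero>" using r a(1) by (simp add: a_minus_def l_distr l_minus r_neg)
    then have "s \<ominus> r \<in> L" using ann s r by (auto simp: left_annihilator_def)
    then have "L +> s = L +> r" using coset_eq_iff[OF L s(1) r] by blast
    then show ?thesis unfolding f_def s_def .
  qed
  have "f \<in> left_ideal_hom R ?P ?Q"
    unfolding left_ideal_hom_def
  proof (intro CollectI conjI ballI funcsetI)
    fix x assume "x \<in> ?P"
    then show "f x \<in> carrier ?Q" by (auto simp: principal_left_ideal_def f S)
  next
    fix x y assume "x \<in> ?P" "y \<in> ?P"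
    then obtain r s where rs: "r \<in> carrier R" "s \<in> carrier R" "x = r \<otimes> a" "y = s \<otimes> a"
      by (auto simp: principal_left_ideal_def)
    then have "x \<oplus> y = (r \<oplus> s) \<otimes> a" using a(1) by (simp add: l_distr)
    then show "f (x \<oplus> y) = f x \<oplus>\<^bsub>?Q\<^esub> f y" using rs by (simp add: f S)
  next
    fix r x assume r: "r \<in> carrier R" and "x \<in> ?P"
    then obtain s where s: "s \<in> carrier R" "x = s \<otimes> a" by (auto simp: principal_left_ideal_def)
    then have "r \<otimes> x = (r \<otimes> s) \<otimes> a" using a(1) r by (simp add: m_assoc)
    then show "f (r \<otimes> x) = r \<odot>\<^bsub>?Q\<^esub> f x" using r s by (simp add: f S)
  qed
  then obtain g where g: "g \<in> left_ideal_hom R (carrier R) ?Q" and eq: "\<forall>x\<in>?P. g x = f x"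
    using ext unfolding pa by blast
  obtain c where c: "c \<in> carrier R" "g \<one> = L +> c"
  proof -
    have "g \<one> \<in> carrier ?Q" using g one_closed unfolding left_ideal_hom_def by blast
    then show ?thesis using that unfolding S(1) by blast
  qed
  have "a \<in> ?P" 
    using a(1) l_one[OF a(1), symmetric] unfolding principal_left_ideal_def by blast
  then have "g a = L +> \<one>" using eq f[of \<one>] a(1) by simp
  moreover have "g a = L +> (a \<otimes> c)"
  proof -
    have "g (a \<otimes> \<one>) = a \<odot>\<^bsub>?Q\<^esub> g \<one>"
      using g a(1) one_closed unfolding left_ideal_hom_def by blast
    then show ?thesis using a(1) c by (simp add: S)
  qed
  ultimately have "L +> \<one> = L +> (a \<otimes> c)" by (rule subst)
  then have "\<one> \<ominus> a \<otimes> c \<in> L" using coset_eq_iff[OF L] a(1) c(1) by blast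
  then show ?thesis using c(1) that by blast
qed

section \<open>Square-zero elements and reducedness\<close>

lemma not_reduced_square_zero:
  assumes "\<not> reduced_ring R"
  obtains a where "a \<in> carrier R" "a \<noteq> \<zero>" "a \<otimes> a = \<zero>"
proof -
  have "\<zero> \<in> nilpotents R" by (auto simp: nilpotents_def intro!: exI[of _ "1::nat"])
  then obtain b where b: "b \<in> carrier R" "b \<noteq> \<zero>" "\<exists>n::nat. b [^] n = \<zero>"
    using assms by (auto simp: reduced_ring_def nilpotents_def)
  \<comment> \<open>The witness will be the last nonvanishing power of \<open>b\<close>.\<close>
  define n :: nat where "n = (LEAST n. b [^] n = \<zero>)"
  have n: "b [^] n = \<zero>" unfolding n_def by (rule LeastI_ex) (rule b(3))
  have less: "b [^] k \<noteq> \<zero>" if "k < n" for k :: nat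
    using that not_less_Least unfolding n_def by blast
  \<comment> \<open>The minimum ranges over all exponents including 0; a vanishing zeroth power
    would make the ring trivial, against b \<noteq> 0.\<close>
  have "n \<noteq> 0"
  proof
    assume "n = 0"
    then have "\<one> = \<zero>" using n by simp
    then show False using b by (metis l_null l_one)
  qed
  moreover have "n \<noteq> 1" using n b by auto
  ultimately have n2: "n \<ge> 2" by simp
  \<comment> \<open>Here 2(n - 1) = n + (n - 2), which is legitimate on naturals because n \<ge>
    2.\<close>
  have "b [^] (n - 1) \<otimes> b [^] (n - 1) = b [^] n \<otimes> b [^] (n - 2)"
    using n2 b(1) by (simp add: nat_pow_mult numeral_2_eq_2)
  then have "b [^] (n - 1) \<otimes> b [^] (n - 1) = \<zero>" using n b(1) by simp
  then show ?thesis using that[of "b [^] (n - 1)"] less[of "n - 1"] n2 b(1) by simp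
qed

lemma LNZS_ideal:
  assumes "LNZS R" "a \<in> carrier R" "a \<otimes> a = \<zero>"
  shows "ideal (left_annihilator R a) R"
proof -
  have "a [^] (2::nat) = \<zero>" using assms by (simp add: numeral_2_eq_2)
  then have "a \<in> nilpotents R"
    using assms(2) by (auto simp: nilpotents_def intro!: exI[of _ "2::nat"])
  then show ?thesis using assms(1) by (simp add: LNZS_def)
qed

lemma semiprime_LNZS_reduced:
  assumes "LNZS R" "semiprime_ring R"
  shows "reduced_ring R"
proof (rule ccontr)
  assume "\<not> reduced_ring R"
  then obtain a where a: "a \<in> carrier R" "a \<noteq> \<zero>" "a \<otimes> a = \<zero>" by (rule not_reduced_square_zero)
  define I where "I = left_annihilator R a"
  interpret I: ideal I R unfolding I_def by (rule LNZS_ideal[OF assms(1) a(1,3)])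
  \<comment> \<open>The part of \<open>I\<close> that \<open>I\<close> annihilates from the left.
    Products of two elements of \<open>J\<close> vanish by definition, and \<open>a\<close> belongs
    to \<open>J\<close> since its square is zero and \<open>I\<close> is its left
    annihilator.\<close>
  define J where "J = {x \<in> I. \<forall>y\<in>I. y \<otimes> x = \<zero>}"
  have J: "ideal J R"
  proof (rule idealI[OF ring_axioms])
    show "subgroup J (add_monoid R)"
      by (rule subgroup.intro)
        (auto simp: J_def r_distr r_minus simp flip: a_inv_def)
  next
    fix x r assume "x \<in> J" and r: "r \<in> carrier R"
    then have x: "x \<in> I" and ann: "\<And>y. y \<in> I \<Longrightarrow> y \<otimes> x = \<zero>" by (auto simp: J_def)
    \<comment> \<open>For \<open>y\<close> in \<open>I\<close>, y(rx) = (yr)x, and yr stays in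
      \<open>I\<close> because LNZS makes \<open>I\<close> a right ideal as well.\<close>
    show "r \<otimes> x \<in> J" using x ann r I.I_l_closed I.I_r_closed
      by (auto simp: J_def simp flip: m_assoc)
    have "y \<otimes> (x \<otimes> r) = \<zero>" if "y \<in> I" for y
      using that x ann[OF that] r m_assoc[of y x r] by simp
    then show "x \<otimes> r \<in> J" using x r I.I_r_closed by (auto simp: J_def)
  qed
  have "J \<cdot>\<^bsub>R\<^esub> J \<subseteq> {\<zero>}"
  proof
    fix x assume "x \<in> J \<cdot>\<^bsub>R\<^esub> J"
    then show "x \<in> {\<zero>}" by (induction rule: ideal_prod.induct) (auto simp: J_def)
  qed
  moreover have "{\<zero>} \<subseteq> J \<cdot>\<^bsub>R\<^esub> J"
    using ideal_prod.prod[of \<zero> J \<zero> J R] additive_subgroup.zero_closed[OF ideal.axioms(1)[OF J]]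
    by simp
  ultimately have "J \<cdot>\<^bsub>R\<^esub> J = {\<zero>}" by (rule equalityI)
  then have "J = {\<zero>}" using J assms(2) unfolding semiprime_ring_def by metis
  moreover have "a \<in> J" using a unfolding J_def I_def left_annihilator_def by blast
  ultimately show False using a(2) by simp
qed

text \<open>The hypothesis on minimal idempotents is what cases (2) and (3) have in common.\<close>

lemma simple_singular_LNZS_reduced:
  assumes lnzs: "LNZS R" and W: "simple_singular_modules_Wnil_injective R"
    and min: "\<And>a e. \<lbrakk>a \<in> carrier R; e \<in> left_minimal_idempotents R;
        \<forall>r\<in>carrier R. a \<otimes> r \<otimes> e = \<zero>\<rbrakk> \<Longrightarrow> e \<otimes> a = \<zero>"
  shows "reduced_ring R"
proof (rule ccontr)
  assume "\<not> reduced_ring R"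
  then obtain a where a: "a \<in> carrier R" "a \<noteq> \<zero>" "a \<otimes> a = \<zero>" by (rule not_reduced_square_zero)
  have "a \<in> left_annihilator R a" using a by (simp add: left_annihilator_def)
  \<comment> \<open>This is where LNZS enters: the annihilator contains \<open>a\<close> and is
    closed under right multiplication.\<close>
  then have aI: "a \<otimes> r \<in> left_annihilator R a" if "r \<in> carrier R" for r
    using ideal.I_r_closed[OF LNZS_ideal[OF lnzs a(1,3)]] that by blast
  have "\<one> \<notin> left_annihilator R a" using a by (simp add: left_annihilator_def)
  then obtain L where L: "maximal_left_ideal L R" and aL: "left_annihilator R a \<subseteq> L"
    using exists_maximal_left_ideal[OF left_ideal_left_annihilator[OF a(1)]] by blast
  have L': "left_ideal L R" and L1: "\<one> \<notin> L" using L by (simp_all add: maximal_left_ideal_def)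
  have "essential_left_ideal L R"
  proof (rule ccontr)
    assume "\<not> essential_left_ideal L R"
    then obtain e where e: "e \<in> left_minimal_idempotents R" "e \<noteq> \<zero>" "L \<subseteq> left_annihilator R e"
      using maximal_left_ideal_not_essential[OF L] by blast
    have ec: "e \<in> carrier R" "e \<otimes> e = e"
      using e(1) by (auto simp: left_minimal_idempotents_def idempotents_def)
    \<comment> \<open>Chain of inclusions: aR lies in the left annihilator of \<open>a\<close>, this
      in \<open>L\<close>, and \<open>L\<close> in the left annihilator of \<open>e\<close>.\<close>
    have "\<forall>r\<in>carrier R. a \<otimes> r \<otimes> e = \<zero>"
      using subsetD[OF e(3) subsetD[OF aL aI]] by (simp add: left_annihilator_def)
    then have "e \<in> left_annihilator R a"
      using min[OF a(1) e(1)] ec by (simp add: left_annihilator_def)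
    then have "e \<in> left_annihilator R e" using aL e(3) by blast
    then have "e \<otimes> e = \<zero>" by (simp add: left_annihilator_def)
    then show False using ec e(2) by simp
  qed
  then have "Wnil_injective R (quotient_left_module R L)"
    using W simple_left_module_quotient[OF L] singular_left_module_quotient
    unfolding simple_singular_modules_Wnil_injective_def by blast
  then obtain c where c: "c \<in> carrier R" "\<one> \<ominus> a \<otimes> c \<in> L"
    using Wnil_injective_quotient_divides[OF L' _ a aL] by blast
  \<comment> \<open>Both summands lie in \<open>L\<close>, the second through \<open>aI\<close>,
    while the sum is \<open>\<one>\<close>.\<close>
  have "(\<one> \<ominus> a \<otimes> c) \<oplus> a \<otimes> c \<in> L"
    using left_idealD(4)[OF L' c(2)] aI[OF c(1)] aL by blast
  then show False using L1 a(1) c(1) by (simp add: a_minus_def a_assoc l_neg)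
qed

end

theorem proposition2p17:
  fixes R :: "('a, 'r) ring_scheme"
  assumes "ring R" and "LNZS R"
  shows "(semiprime_ring R \<longrightarrow> reduced_ring R) \<and>
    (left_MC2 R \<and> simple_singular_modules_Wnil_injective R \<longrightarrow> reduced_ring R) \<and>
    ((\<forall>e \<in> idempotents R. right_semicentral R e) \<and>
       simple_singular_modules_Wnil_injective R \<longrightarrow> reduced_ring R)"
proof -
  interpret ring R by (rule assms(1))
  have idem: "e \<in> carrier R" if "e \<in> left_minimal_idempotents R" for e
    using that by (simp add: left_minimal_idempotents_def idempotents_def)
  have "reduced_ring R" if "semiprime_ring R"
    using semiprime_LNZS_reduced[OF assms(2) that] .
  moreover have "reduced_ring R"
    if MC2: "left_MC2 R" and W: "simple_singular_modules_Wnil_injective R"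
  proof (rule simple_singular_LNZS_reduced[OF assms(2) W])
    fix a e
    assume a: "a \<in> carrier R" and e: "e \<in> left_minimal_idempotents R"
      and "\<forall>r\<in>carrier R. a \<otimes>\<^bsub>R\<^esub> r \<otimes>\<^bsub>R\<^esub> e = \<zero>\<^bsub>R\<^esub>"
    \<comment> \<open>MC2 turns aRe = 0 into eRa = 0, read off at the identity.\<close>
    then have "e \<otimes>\<^bsub>R\<^esub> \<one>\<^bsub>R\<^esub> \<otimes>\<^bsub>R\<^esub> a = \<zero>\<^bsub>R\<^esub>" using MC2 one_closed unfolding left_MC2_def by blast
    then show "e \<otimes>\<^bsub>R\<^esub> a = \<zero>\<^bsub>R\<^esub>" using idem[OF e] by simp
  qed
  moreover have "reduced_ring R"
    if sc: "\<forall>e \<in> idempotents R. right_semicentral R e"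
      and W: "simple_singular_modules_Wnil_injective R"
  proof (rule simple_singular_LNZS_reduced[OF assms(2) W])
    fix a e
    assume a: "a \<in> carrier R" and e: "e \<in> left_minimal_idempotents R"
      and ann: "\<forall>r\<in>carrier R. a \<otimes>\<^bsub>R\<^esub> r \<otimes>\<^bsub>R\<^esub> e = \<zero>\<^bsub>R\<^esub>"
    have "right_semicentral R e" using sc e by (simp add: left_minimal_idempotents_def)
    \<comment> \<open>Semicentrality gives ea = eae, and ae = 0 is the case r = 1 of aRe =
      0.\<close>
    then have "e \<otimes>\<^bsub>R\<^esub> a = e \<otimes>\<^bsub>R\<^esub> (a \<otimes>\<^bsub>R\<^esub> e)"
      unfolding right_semicentral_def using a m_assoc[OF idem[OF e] a idem[OF e]] by metis
    moreover have "a \<otimes>\<^bsub>R\<^esub> e = \<zero>\<^bsub>R\<^esub>" using ann a by (metis one_closed r_one)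
    ultimately show "e \<otimes>\<^bsub>R\<^esub> a = \<zero>\<^bsub>R\<^esub>" using idem[OF e] by simp
  qed
  ultimately show ?thesis by blast
qed

end
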